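(* Let $(X,\|\cdot\|)$ be a normed vector space that is uniformly uniquely geodesic with a modulus of uniform uniqueness $\Phi:(0,\infty)^2\to(0,\infty)$ satisfying $\Phi<1$ (i.e. $\Phi(\varepsilon,b)<1$ for all $\varepsilon,b>0$). Then $X$ is uniformly convex and its modulus of convexity $\delta$ satisfies $$\delta(\varepsilon)\ge\frac12\,\Phi\!\left(\frac{\varepsilon}{3},1\right)\quad\text{for all }\varepsilon\in(0,2].$$ In particular, $\eta:(0,2]\to(0,1]$ defined by $\eta(\varepsilon)=\frac12\Phi\left(\frac{\varepsilon}{3},1\right)$ is a modulus of uniform convexity for $X$.
   Context: A normed space is regarded as a geodesic metric space with $d(x,y)=\|x-y\|$. A geodesic space $(X,d)$ is uniformly uniquely geodesic if for all $\varepsilon,b>0$ there exists $\varphi>0$ such that for all $x,y,z,w\in X$ with $d(x,y)\le b$ and all $t\in[0,1]$: $\max\{d(z,x),d(w,x)\}\le t\,d(x,y)$ and $\max\{d(z,y),d(w,y)\}\le(1-t)\,d(x,y)+\varphi$ imply $d(z,w)\le\varepsilon$. A map $\Phi:(0,\infty)^2\to(0,\infty)$ such that $\varphi=\Phi(\varepsilon,b)$ works for all $\varepsilon,b>0$ is called a modulus of uniform uniqueness. The modulus of convexity of a normed space $X$ is the function $\delta:[0,2]\to[0,1]$, $\delta(\varepsilon)=\inf\{1-\|\frac{x+y}{2}\| : \|x\|\le1,\ \|y\|\le1,\ \|x-y\|\ge\varepsilon\}$ (infimum taken in $[0,1]$). $X$ is uniformly convex if and only if $\delta(\varepsilon)>0$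 for all $\varepsilon\in(0,2]$. A function $\eta:(0,2]\to(0,1]$ is a modulus of uniform convexity for $X$ (not depending on the radius) if for all $\varepsilon\in(0,2]$, $r>0$ and $x,y,z\in X$: $\|z-x\|\le r$, $\|z-y\|\le r$, $\|x-y\|\ge\varepsilon r$ imply $\|z-\frac{x+y}{2}\|\le(1-\eta(\varepsilon))r$. *)

theory Defs
  imports "HOL-Analysis.Analysis"
begin

text \<open>
  All notions are attached to a type: the space $X$ is the type, with the metric \<open>dist\<close>
  (for normed spaces \<open>dist x y = norm (x - y)\<close>). Functions with a restricted domain or
  codomain are total functions on \<open>real\<close> whose values are only constrained on the
  intended domain.
\<close>

definition geodesic_path :: "'a::metric_space \<Rightarrow> 'a \<Rightarrow> (real \<Rightarrow> 'a) \<Rightarrow> bool" where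
  "geodesic_path x y \<gamma> \<longleftrightarrow>
     \<gamma> 0 = x \<and> \<gamma> (dist x y) = y \<and>
     (\<forall>s\<in>{0..dist x y}. \<forall>t\<in>{0..dist x y}. dist (\<gamma> s) (\<gamma> t) = \<bar>s - t\<bar>)"

definition geodesic_space :: "'a::metric_space itself \<Rightarrow> bool" where
  "geodesic_space _ \<longleftrightarrow> (\<forall>x y :: 'a. \<exists>\<gamma>. geodesic_path x y \<gamma>)"

lemma geodesic_space_real_normed_vector:
  "geodesic_space TYPE('a::real_normed_vector)"
  unfolding geodesic_space_def
proof (intro allI)
  fix x y :: 'a
  let ?\<gamma> = "\<lambda>s. x + (s / dist x y) *\<^sub>R (y - x)"
  show "\<exists>\<gamma>. geodesic_path x y \<gamma>"
  proof (cases "x = y")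
    case True
    then have "geodesic_path x y (\<lambda>_. x)" by (simp add: geodesic_path_def)
    then show ?thesis by blast
  next
    case False
    have "dist (?\<gamma> s) (?\<gamma> t) = \<bar>s - t\<bar>" for s t
    proof -
      have "?\<gamma> s - ?\<gamma> t = ((s - t) / dist x y) *\<^sub>R (y - x)"
        by (simp add: algebra_simps diff_divide_distrib)
      then have "dist (?\<gamma> s) (?\<gamma> t) = norm (((s - t) / dist x y) *\<^sub>R (y - x))"
        by (simp only: dist_norm)
      also have "\<dots> = \<bar>s - t\<bar> / dist x y * dist x y"
        by (simp add: dist_norm norm_minus_commute)
      also have "\<dots> = \<bar>s - t\<bar>" using False by simp
      finally show ?thesis .
    qed
    with False have "geodesic_path x y ?\<gamma>" by (simp add: geodesic_path_def)
    then show ?thesis by blast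
  qed
qed

definition uniform_uniqueness_at ::
    "'a::metric_space itself \<Rightarrow> real \<Rightarrow> real \<Rightarrow> real \<Rightarrow> bool" where
  "uniform_uniqueness_at _ \<epsilon> b \<phi> \<longleftrightarrow>
     (\<forall>x y z w :: 'a. dist x y \<le> b \<longrightarrow>
        (\<forall>t\<in>{0..1}.
           max (dist z x) (dist w x) \<le> t * dist x y \<and>
           max (dist z y) (dist w y) \<le> (1 - t) * dist x y + \<phi> \<longrightarrow>
           dist z w \<le> \<epsilon>))"

definition uniformly_uniquely_geodesic :: "'a::metric_space itself \<Rightarrow> bool" where
  "uniformly_uniquely_geodesic X \<longleftrightarrow>
     geodesic_space X \<and> (\<forall>\<epsilon>>0. \<forall>b>0. \<exists>\<phi>>0. uniform_uniqueness_at X \<epsilon> b \<phi>)"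

definition modulus_of_uniform_uniqueness ::
    "'a::metric_space itself \<Rightarrow> (real \<Rightarrow> real \<Rightarrow> real) \<Rightarrow> bool" where
  "modulus_of_uniform_uniqueness X \<Phi> \<longleftrightarrow>
     (\<forall>\<epsilon>>0. \<forall>b>0. \<Phi> \<epsilon> b > 0 \<and> uniform_uniqueness_at X \<epsilon> b (\<Phi> \<epsilon> b))"

text \<open>
  The infimum is taken in the complete lattice $[0,1]$, where the infimum of the empty set
  is 1 (this matters only for the zero space). All values \<open>1 - norm ((x + y) /\<^sub>R 2)\<close> below
  lie in $[0,1]$, so inserting 1 gives exactly that infimum.
\<close>

definition modulus_of_convexity :: "'a::real_normed_vector itself \<Rightarrow> real \<Rightarrow> real" where
  "modulus_of_convexity _ \<epsilon> =
     Inf (insert 1 {1 - norm ((x + y) /\<^sub>R 2) | x y :: 'a.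
                      norm x \<le> 1 \<and> norm y \<le> 1 \<and> norm (x - y) \<ge> \<epsilon>})"

definition uniformly_convex :: "'a::real_normed_vector itself \<Rightarrow> bool" where
  "uniformly_convex X \<longleftrightarrow> (\<forall>\<epsilon>\<in>{0<..2}. modulus_of_convexity X \<epsilon> > 0)"

definition modulus_of_uniform_convexity ::
    "'a::real_normed_vector itself \<Rightarrow> (real \<Rightarrow> real) \<Rightarrow> bool" where
  "modulus_of_uniform_convexity _ \<eta> \<longleftrightarrow>
     (\<forall>\<epsilon>\<in>{0<..2}. \<eta> \<epsilon> \<in> {0<..1} \<and>
        (\<forall>r>0. \<forall>x y z :: 'a.
           norm (z - x) \<le> r \<and> norm (z - y) \<le> r \<and> norm (x - y) \<ge> \<epsilon> * r \<longrightarrow>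
           norm (z - (x + y) /\<^sub>R 2) \<le> (1 - \<eta> \<epsilon>) * r))"

end

theory Submission
  imports Defs
begin

text \<open>
  Let \<open>x\<close>, \<open>y\<close> lie in the unit ball, with midpoint \<open>m\<close>. The points \<open>x / 2\<close> and \<open>y / 2\<close> are both
  within \<open>1 / 2\<close> of \<open>0\<close> and of \<open>m\<close>, because \<open>m - x / 2 = y / 2\<close>. If \<open>m\<close> has norm close to 1, they are
  thus almost midpoints of \<open>0\<close> and \<open>m\<close>, and uniform uniqueness (with \<open>t = 1 / (2 * norm m)\<close>) forces
  them to be close to each other.
\<close>

lemma uniform_uniqueness_at_imp_norm_midpoint_le:
  fixes x y :: "'a::real_normed_vector"
  assumes uniq: "uniform_uniqueness_at TYPE('a) \<epsilon> 1 \<phi>"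
    and \<phi>: "0 < \<phi>" "\<phi> < 1"
    and x: "norm x \<le> 1" and y: "norm y \<le> 1"
    and far: "norm (x - y) > 2 * \<epsilon>"
  shows "norm ((x + y) /\<^sub>R 2) \<le> 1 - \<phi> / 2"
proof (rule ccontr)
  define m where "m = (x + y) /\<^sub>R 2"
  define z where "z = x /\<^sub>R 2"
  define w where "w = y /\<^sub>R 2"
  define t where "t = 1 / (2 * norm m)"
  assume "\<not> ?thesis"
  then have m: "norm m > 1 - \<phi> / 2" by (simp add: m_def)
  \<comment> \<open>\<open>\<phi> < 1\<close> enters here: the loss of only
    \<open>\<phi> / 2\<close> keeps \<open>norm m\<close> above \<open>1 / 2\<close>, so that
    \<open>t\<close> does not exceed 1.\<close>
  with \<phi> have half: "norm m > 1 / 2" by linarith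
  have "m = z + w" by (simp add: m_def z_def w_def scaleR_add_right)
  then have "dist z m = norm w" "dist w m = norm z"
    by (simp_all add: dist_norm)
  moreover have zw: "norm z \<le> 1 / 2" "norm w \<le> 1 / 2"
    using x y by (simp_all add: z_def w_def)
  \<comment> \<open>The geodesic in question runs from \<open>0\<close> to \<open>m\<close>; its
    length is at most 1, which is why the modulus is taken at \<open>b = 1\<close>.\<close>
  moreover have "norm m \<le> 1"
    using zw norm_triangle_ineq[of z w] \<open>m = z + w\<close> by simp
  moreover have "t \<in> {0..1}" "t * norm m = 1 / 2"
    using half by (auto simp: t_def divide_simps)
  \<comment> \<open>Since \<open>norm m > 1 - \<phi> / 2\<close>, this exceeds \<open>1 / 2\<close>,
    the bound on the distances from \<open>z\<close> and \<open>w\<close> to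
    \<open>m\<close>.\<close>
  moreover have "(1 - t) * norm m + \<phi> = norm m - 1 / 2 + \<phi>"
    using \<open>t * norm m = 1 / 2\<close> by (simp add: algebra_simps)
  ultimately have "dist z w \<le> \<epsilon>"
    using m \<phi> uniq[unfolded uniform_uniqueness_at_def, rule_format, of 0 m t z w] by simp
  moreover have "z - w = (x - y) /\<^sub>R 2"
    by (simp add: z_def w_def scaleR_diff_right)
  then have "dist z w = norm (x - y) / 2" by (simp add: dist_norm)
  ultimately show False using far by simp
qed

text \<open>Any lower bound of a nonempty set lies below its infimum. The condition
  \<open>c \<le> 1\<close> accounts for the inserted value 1.\<close>

lemma modulus_of_convexity_geI:
  assumes "c \<le> 1"
    and "\<And>x y :: 'a::real_normed_vector.
      norm x \<le> 1 \<Longrightarrow> norm y \<le> 1 \<Longrightarrow> norm (x - y) \<ge> \<epsilon> \<Longrightarrow> norm ((x + y) /\<^sub>R 2) \<le> 1 - c"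
  shows "modulus_of_convexity TYPE('a) \<epsilon> \<ge> c"
  unfolding modulus_of_convexity_def
proof (rule cInf_greatest)
  fix v
  assume "v \<in> insert 1 {1 - norm ((x + y) /\<^sub>R 2) | x y :: 'a.
      norm x \<le> 1 \<and> norm y \<le> 1 \<and> norm (x - y) \<ge> \<epsilon>}"
  then consider "v = 1"
    | x y :: 'a where "v = 1 - norm ((x + y) /\<^sub>R 2)"
        "norm x \<le> 1" "norm y \<le> 1" "norm (x - y) \<ge> \<epsilon>"
    by blast
  then show "c \<le> v"
  proof cases
    case 1
    with assms(1) show ?thesis by simp
  next
    case (2 x y)
    from assms(2)[OF 2(2-4)] 2(1) show ?thesis by linarith
  qed
qed simp

text \<open>Midpoints are preserved by affine maps: reflecting through \<open>z\<close> and dividing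
  by \<open>r\<close> carries the ball of radius \<open>r\<close> around \<open>z\<close> to the
  unit ball, so the same \<open>c\<close> serves every radius.\<close>

lemma norm_midpoint_le_rescale:
  fixes x y z :: "'a::real_normed_vector"
  assumes unit: "\<And>x y :: 'a.
      norm x \<le> 1 \<Longrightarrow> norm y \<le> 1 \<Longrightarrow> norm (x - y) \<ge> \<epsilon> \<Longrightarrow> norm ((x + y) /\<^sub>R 2) \<le> 1 - c"
    and r: "r > 0"
    and x: "norm (z - x) \<le> r" and y: "norm (z - y) \<le> r"
    and far: "norm (x - y) \<ge> \<epsilon> * r"
  shows "norm (z - (x + y) /\<^sub>R 2) \<le> (1 - c) * r"
proof -
  define u where "u = (z - x) /\<^sub>R r"
  define v where "v = (z - y) /\<^sub>R r"
  have "v - u = (x - y) /\<^sub>R r"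
    by (simp add: u_def v_def flip: scaleR_diff_right)
  then have "norm (u - v) = norm (x - y) / r"
    using r by (simp add: norm_minus_commute[of u v] divide_inverse mult.commute)
  then have "norm (u - v) \<ge> \<epsilon>" using far r by (simp add: pos_le_divide_eq)
  moreover have "norm u \<le> 1" "norm v \<le> 1"
    using x y r by (simp_all add: u_def v_def divide_simps)
  ultimately have "norm ((u + v) /\<^sub>R 2) \<le> 1 - c" by (rule unit[rotated 2])
  moreover have "z - (x + y) /\<^sub>R 2 = r *\<^sub>R ((u + v) /\<^sub>R 2)"
  proof -
    have "r *\<^sub>R (u + v) = (z + z) - (x + y)"
      using r by (simp add: u_def v_def scaleR_add_right)
    then have "r *\<^sub>R ((u + v) /\<^sub>R 2) = (z + z) /\<^sub>R 2 - (x + y) /\<^sub>R 2"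
      by (metis scaleR_left_commute scaleR_diff_right)
    \<comment> \<open>The two copies of \<open>z\<close>, one from each of \<open>u\<close> and
      \<open>v\<close>, average to \<open>z\<close>.\<close>
    then show ?thesis by (simp flip: scaleR_2)
  qed
  ultimately show ?thesis using r by (simp add: mult.commute[of _ r])
qed

theorem theorem3p8:
  fixes \<Phi> :: "real \<Rightarrow> real \<Rightarrow> real"
  assumes "uniformly_uniquely_geodesic TYPE('a::real_normed_vector)"
    and "modulus_of_uniform_uniqueness TYPE('a) \<Phi>"
    and "\<forall>\<epsilon>>0. \<forall>b>0. \<Phi> \<epsilon> b < 1"
  shows "uniformly_convex TYPE('a) \<and>
    (\<forall>\<epsilon>\<in>{0<..2}. modulus_of_convexity TYPE('a) \<epsilon> \<ge> 1 / 2 * \<Phi> (\<epsilon> / 3) 1) \<and>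
    modulus_of_uniform_convexity TYPE('a) (\<lambda>\<epsilon>. 1 / 2 * \<Phi> (\<epsilon> / 3) 1)"
proof -
  have \<Phi>: "0 < \<Phi> (\<epsilon> / 3) 1" "\<Phi> (\<epsilon> / 3) 1 < 1"
    "uniform_uniqueness_at TYPE('a) (\<epsilon> / 3) 1 (\<Phi> (\<epsilon> / 3) 1)" if "\<epsilon> > 0" for \<epsilon>
    using that assms(2,3) by (simp_all add: modulus_of_uniform_uniqueness_def)
  have mid: "norm ((x + y) /\<^sub>R 2) \<le> 1 - 1 / 2 * \<Phi> (\<epsilon> / 3) 1"
    if "\<epsilon> > 0" "norm x \<le> 1" "norm y \<le> 1" "norm (x - y) \<ge> \<epsilon>" for \<epsilon> and x y :: 'a
    \<comment> \<open>The separation must be strictly larger than twice the first argument of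
      \<open>\<Phi>\<close>. With \<open>\<epsilon> / 3\<close> this holds because
      \<open>2 * \<epsilon> / 3 < \<epsilon>\<close>; with \<open>\<epsilon> / 2\<close> equality
      could occur.\<close>
    using uniform_uniqueness_at_imp_norm_midpoint_le[OF \<Phi>(3,1,2), of \<epsilon> x y] that by simp
  have ge: "modulus_of_convexity TYPE('a) \<epsilon> \<ge> 1 / 2 * \<Phi> (\<epsilon> / 3) 1" if "\<epsilon> > 0" for \<epsilon>
    using \<Phi>(2)[OF that] mid[OF that] by (intro modulus_of_convexity_geI) auto
  have "uniformly_convex TYPE('a)"
    unfolding uniformly_convex_def
  proof
    fix \<epsilon> :: real
    assume "\<epsilon> \<in> {0<..2}"
    then show "modulus_of_convexity TYPE('a) \<epsilon> > 0"
      using ge[of \<epsilon>] \<Phi>(1)[of \<epsilon>] by simp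
  qed
  moreover have "modulus_of_uniform_convexity TYPE('a) (\<lambda>\<epsilon>. 1 / 2 * \<Phi> (\<epsilon> / 3) 1)"
    unfolding modulus_of_uniform_convexity_def
  proof (intro ballI conjI allI impI)
    fix \<epsilon> :: real
    assume \<epsilon>: "\<epsilon> \<in> {0<..2}"
    then show "1 / 2 * \<Phi> (\<epsilon> / 3) 1 \<in> {0<..1}"
      using \<Phi>(1,2)[of \<epsilon>] by simp
    fix r :: real and x y z :: 'a
    assume "r > 0" and "norm (z - x) \<le> r \<and> norm (z - y) \<le> r \<and> norm (x - y) \<ge> \<epsilon> * r"
    with \<epsilon> show "norm (z - (x + y) /\<^sub>R 2) \<le> (1 - 1 / 2 * \<Phi> (\<epsilon> / 3) 1) * r"
      by (intro norm_midpoint_le_rescale[OF mid]) auto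
  qed
  ultimately show ?thesis using ge by simp
qed

end
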